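(* Let $n\ge3$, $k\in\mathbb N$, $s\in\mathbb N$ with $s>1$, and $a_1,\dots,a_s,b_1,\dots,b_{s-1}\in\mathbb N$. Then, as projective transformations (that is, in $\mathrm{PSL}_2(\mathbb R)$), $$CA^{-1}C\,(A^{-k}C)^{a_s}(A^{-(k+1)}C)^{b_{s-1}}(A^{-k}C)^{a_{s-1}}\cdots(A^{-(k+1)}C)^{b_1}(A^{-k}C)^{a_1}A^{-1}$$ $$=E^{a_s}F^{b_{s-1}-1}G\cdot E^{1+a_{s-1}}F^{b_{s-2}-1}G\cdots E^{1+a_2}F^{b_1-1}G\cdot E^{a_1}(AC^2)^{n-3}U^{k-1},$$ where $E=(AC^2)^{n-3}U^{k-2}AC$, $F=(AC^2)^{n-3}U^{k-1}AC$, $G=(AC^2)^{n-3}ACAC^2$ (for $s=2$ the right-hand side is $E^{a_2}F^{b_1-1}G\cdot E^{a_1}(AC^2)^{n-3}U^{k-1}$).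
   Context: $\mathbb N=\{1,2,\dots\}$. For $n\ge3$ put $t=1+2\cos(\pi/n)$, $A=\begin{pmatrix}1&t\\0&1\end{pmatrix}$, $C=\begin{pmatrix}-1&1\\-1&0\end{pmatrix}$ and $U=AC(AC^{2})^{n-2}$. All matrices are considered projectively, i.e. up to sign. *)

theory Defs
  imports "HOL-Analysis.Analysis"
begin

definition sl2_eq_up_to_sign :: "real^2^2 \<Rightarrow> real^2^2 \<Rightarrow> bool" where
  "sl2_eq_up_to_sign M N \<longleftrightarrow> det M = 1 \<and> det N = 1 \<and> (M = N \<or> M = - N)"

lemma det_uminus_2: "det (- M) = det (M :: real^2^2)"
  by (simp add: det_2)

lemma matrix_mul_uminus_left: "(- M) ** N = - (M ** (N :: real^2^2))"
  by (simp add: matrix_matrix_mult_def vec_eq_iff sum_negf)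

lemma matrix_mul_uminus_right: "M ** (- N) = - ((M :: real^2^2) ** N)"
  by (simp add: matrix_matrix_mult_def vec_eq_iff sum_negf)

lemma det_1_matrix_inv:
  fixes M :: "real^2^2"
  assumes "det M = 1"
  shows "M ** matrix_inv M = mat 1" "matrix_inv M ** M = mat 1" "det (matrix_inv M) = 1"
proof -
  have "invertible M"
    using assms by (simp add: invertible_det_nz)
  hence inv: "M ** matrix_inv M = mat 1 \<and> matrix_inv M ** M = mat 1"
    unfolding invertible_def matrix_inv_def by (rule someI_ex)
  thus r: "M ** matrix_inv M = mat 1" and "matrix_inv M ** M = mat 1"
    by simp_all
  have "det M * det (matrix_inv M) = 1"
    by (metis r det_mul det_I)
  thus "det (matrix_inv M) = 1"
    using assms by simp
qed

lemma matrix_inv_uminus_2: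
  fixes M :: "real^2^2"
  assumes "det M = 1"
  shows "matrix_inv (- M) = - matrix_inv M"
proof -
  have "matrix_inv (- M) = matrix_inv (- M) ** (M ** matrix_inv M)"
    using assms by (simp add: det_1_matrix_inv)
  also have "\<dots> = - ((matrix_inv (- M) ** (- M)) ** matrix_inv M)"
    by (simp add: matrix_mul_assoc matrix_mul_uminus_left matrix_mul_uminus_right)
  also have "\<dots> = - matrix_inv M"
    using assms by (simp add: det_1_matrix_inv det_uminus_2)
  finally show ?thesis .
qed

quotient_type psl2r = "real^2^2" / partial: sl2_eq_up_to_sign
proof (rule part_equivpI)
  show "\<exists>M. sl2_eq_up_to_sign M M"
    by (rule exI[of _ "mat 1"]) (simp add: sl2_eq_up_to_sign_def)
  show "symp sl2_eq_up_to_sign"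
    by (auto simp: symp_def sl2_eq_up_to_sign_def)
  show "transp sl2_eq_up_to_sign"
    by (auto simp: transp_def sl2_eq_up_to_sign_def)
qed

instantiation psl2r :: "{monoid_mult, inverse}"
begin

lift_definition one_psl2r :: psl2r is "mat 1"
  by (simp add: sl2_eq_up_to_sign_def)

text \<open>On \<^typ>\<open>real^2^2\<close> the operator \<open>*\<close> is the componentwise product; on the quotient
  it is the matrix product.\<close>

lift_definition times_psl2r :: "psl2r \<Rightarrow> psl2r \<Rightarrow> psl2r" is "(**)"
  by (auto simp: sl2_eq_up_to_sign_def det_mul matrix_mul_uminus_left matrix_mul_uminus_right)

lift_definition inverse_psl2r :: "psl2r \<Rightarrow> psl2r" is matrix_inv
  by (auto simp: sl2_eq_up_to_sign_def det_1_matrix_inv matrix_inv_uminus_2 det_uminus_2)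

definition divide_psl2r :: "psl2r \<Rightarrow> psl2r \<Rightarrow> psl2r" where
  "divide_psl2r x y = x * inverse y"

instance
  by standard
     (transfer; auto simp: sl2_eq_up_to_sign_def det_mul matrix_mul_assoc)+

end

lemma psl2r_left_inverse: "inverse x * x = (1 :: psl2r)"
  by transfer (auto simp: sl2_eq_up_to_sign_def det_1_matrix_inv)

lemma psl2r_right_inverse: "x * inverse x = (1 :: psl2r)"
  by transfer (auto simp: sl2_eq_up_to_sign_def det_1_matrix_inv)

lift_definition psl_A :: "nat \<Rightarrow> psl2r" is
  "\<lambda>n. vector [vector [1, 1 + 2 * cos (pi / real n)], vector [0, 1]]"
  by (simp add: sl2_eq_up_to_sign_def det_2)

lift_definition psl_C :: psl2r is "vector [vector [-1, 1], vector [-1, 0]]"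
  by (simp add: sl2_eq_up_to_sign_def det_2)

definition psl_U :: "nat \<Rightarrow> psl2r" where
  "psl_U n = psl_A n * psl_C * (psl_A n * psl_C ^ 2) ^ (n - 2)"

end

theory Submission
  imports Defs
begin

text \<open>
  Everything takes place in the group generated by \<open>A\<close> and \<open>C\<close>, and two relations suffice:
  \<open>C\<^sup>3 = 1\<close> and \<open>B\<^sup>n = 1\<close> for \<open>B = AC\<^sup>2 = AC\<^sup>-\<^sup>1\<close>. The second holds because \<open>B\<close> has
  determinant 1 and trace \<open>2 cos (\<pi>/n)\<close>, so it is a rotation through an angle \<open>\<pi>/n\<close> up to
  conjugation (\<open>rotation_power_eq_one\<close>).

  The relation \<open>B\<^sup>n = 1\<close> turns \<open>U = AC B\<^sup>n\<^sup>-\<^sup>2\<close> into the conjugate \<open>B A\<^sup>-\<^sup>1 B\<^sup>-\<^sup>1\<close>, so the powers of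
  \<open>U\<close> are known. Put \<open>X = CA\<^sup>-\<^sup>1C\<close>, \<open>P = A\<^sup>-\<^sup>kC\<close> and \<open>Q = A\<^sup>-\<^sup>(\<^sup>k\<^sup>+\<^sup>1\<^sup>)C\<close>. Cancelling in
  the words for \<open>E\<close>, \<open>F\<close>, \<open>G\<close> gives
  \<open>E = X P X\<^sup>-\<^sup>1\<close>, \<open>F = X Q X\<^sup>-\<^sup>1\<close> and \<open>G = X A\<^sup>-\<^sup>1 X\<^sup>-\<^sup>1 = X (Q P\<^sup>-\<^sup>1) X\<^sup>-\<^sup>1\<close>, while the last
  factor \<open>B\<^sup>n\<^sup>-\<^sup>3 U\<^sup>k\<^sup>-\<^sup>1\<close> equals \<open>X P A\<^sup>-\<^sup>1\<close>.

  Hence each block \<open>F\<^sup>b\<^sup>-\<^sup>1 G\<close> is the conjugate by \<open>X\<close> of \<open>Q\<^sup>b P\<^sup>-\<^sup>1\<close>. The surplus \<open>P\<^sup>-\<^sup>1\<close>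
  cancels the 1 in the next exponent \<open>1 + a\<^sub>i\<close>, or the \<open>P\<close> in the last factor, and the product
  telescopes (\<open>conjugated_product_telescope\<close>).
\<close>

section \<open>Group calculus in the projective special linear group\<close>

lemma psl2r_cancel:
  fixes x y :: psl2r
  shows "x * (inverse x * y) = y" "inverse x * (x * y) = y"
  by (simp_all flip: mult.assoc add: psl2r_left_inverse psl2r_right_inverse)

lemma psl2r_inverse_unique:
  fixes x y :: psl2r
  assumes "x * y = 1"
  shows "inverse x = y"
  by (metis assms mult.right_neutral psl2r_cancel(2))

lemma psl2r_inverse_inverse: "inverse (inverse x) = (x :: psl2r)"
  by (rule psl2r_inverse_unique) (rule psl2r_left_inverse)

lemma psl2r_inverse_mult: "inverse (x * y) = inverse y * inverse (x :: psl2r)"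
  by (rule psl2r_inverse_unique) (simp add: mult.assoc psl2r_cancel psl2r_right_inverse)

lemmas psl2r_word_simps = mult.assoc psl2r_cancel psl2r_left_inverse psl2r_right_inverse
  psl2r_inverse_inverse psl2r_inverse_mult

lemma psl2r_power_conjugate: "(x * y * inverse x) ^ m = x * y ^ m * inverse (x :: psl2r)"
  by (induction m) (simp_all add: psl2r_word_simps)

section \<open>Two relations between the generators\<close>

lemma abs_psl2r_power:
  assumes "det M = 1"
  shows "det (((**) M ^^ m) (mat 1)) = 1"
    and "abs_psl2r M ^ m = abs_psl2r (((**) M ^^ m) (mat 1))"
proof -
  show dets: "det (((**) M ^^ m) (mat 1)) = 1" for m
    by (induction m) (simp_all add: assms det_mul)
  show "abs_psl2r M ^ m = abs_psl2r (((**) M ^^ m) (mat 1))"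
    by (induction m)
      (simp_all add: one_psl2r_def times_psl2r.abs_eq sl2_eq_up_to_sign_def assms dets)
qed

text \<open>By the Cayley-Hamilton theorem \<open>M\<^sup>2 = 2 cos \<theta> M - 1\<close>, so the coefficients of the powers of
  \<open>M\<close> in terms of \<open>M\<close> and \<open>1\<close> obey the recursion of the Chebyshev polynomials, which
  \<open>sin (m\<theta>)\<close> solves. The factor \<open>sin \<theta>\<close> avoids a division.\<close>
lemma sin_scaled_matrix_power:
  fixes M :: "real^2^2"
  assumes "det M = 1" and "M$1$1 + M$2$2 = 2 * cos \<theta>"
  shows "sin \<theta> *\<^sub>R ((**) M ^^ m) (mat 1) = sin (m * \<theta>) *\<^sub>R M - sin (m * \<theta> - \<theta>) *\<^sub>R mat 1"
proof (induction m)
  case 0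
  then show ?case by simp
next
  case (Suc m)
  have cayley_hamilton: "M ** M = (2 * cos \<theta>) *\<^sub>R M - mat 1"
    using assms(1) unfolding assms(2)[symmetric] det_2
    by (simp add: vec_eq_iff matrix_matrix_mult_def forall_2 sum_2 mat_def algebra_simps)
  have "sin \<theta> *\<^sub>R ((**) M ^^ Suc m) (mat 1) = M ** (sin \<theta> *\<^sub>R ((**) M ^^ m) (mat 1))"
    by (simp add: matrix_scalar_ac scalar_matrix_assoc)
  also have "\<dots> = sin (m * \<theta>) *\<^sub>R (M ** M) - sin (m * \<theta> - \<theta>) *\<^sub>R M"
    unfolding Suc.IH
    by (simp add: vec_eq_iff matrix_matrix_mult_def forall_2 sum_2 mat_def algebra_simps)
  also have "\<dots> = (2 * cos \<theta> * sin (m * \<theta>) - sin (m * \<theta> - \<theta>)) *\<^sub>R M - sin (m * \<theta>) *\<^sub>R mat 1"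
    unfolding cayley_hamilton by (simp add: algebra_simps)
  also have "2 * cos \<theta> * sin (m * \<theta>) - sin (m * \<theta> - \<theta>) = sin (Suc m * \<theta>)"
    by (simp add: sin_diff sin_add distrib_right)
  also have "m * \<theta> = Suc m * \<theta> - \<theta>"
    by (simp add: distrib_right)
  finally show ?case
    by simp
qed

text \<open>A matrix with these invariants is conjugate to the rotation through \<open>\<pi>/n\<close>, whose \<open>n\<close>-th power
  is \<open>-1\<close>, which is trivial projectively.\<close>
lemma rotation_power_eq_one:
  fixes M :: "real^2^2"
  assumes "n \<ge> 2" and "det M = 1" and "M$1$1 + M$2$2 = 2 * cos (pi / real n)"
  shows "abs_psl2r M ^ n = 1"
proof -
  let ?\<theta> = "pi / real n"
  have "0 < ?\<theta>" "?\<theta> < pi"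
    using assms(1) by (simp_all add: field_simps)
  then have "sin ?\<theta> \<noteq> 0"
    using sin_gt_zero by fastforce
  moreover have "sin ?\<theta> *\<^sub>R ((**) M ^^ n) (mat 1) = sin ?\<theta> *\<^sub>R (- mat 1)"
    using sin_scaled_matrix_power[OF assms(2,3), of n] assms(1) by simp
  ultimately have "((**) M ^^ n) (mat 1) = - mat 1"
    by (metis scaleR_cancel_left)
  then have "abs_psl2r M ^ n = abs_psl2r (- mat 1)"
    using abs_psl2r_power(2)[OF assms(2)] by simp
  also have "\<dots> = 1"
    unfolding one_psl2r_def
    by (rule Quotient3_rel_abs[OF Quotient3_psl2r])
      (simp add: sl2_eq_up_to_sign_def det_uminus_2)
  finally show ?thesis .
qed

lemma psl_C_squared: "psl_C ^ 2 = inverse psl_C"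
proof -
  have "psl_C * psl_C ^ 2 = 1"
    unfolding power2_eq_square
    by transfer
      (simp add: sl2_eq_up_to_sign_def det_2 vec_eq_iff matrix_matrix_mult_def forall_2 sum_2 mat_def)
  then show ?thesis
    by (rule psl2r_inverse_unique[symmetric])
qed

lemma psl_A_C_squared_order:
  assumes "n \<ge> 2"
  shows "(psl_A n * psl_C ^ 2) ^ n = 1"
proof -
  define MA :: "real^2^2" where
    "MA = vector [vector [1, 1 + 2 * cos (pi / real n)], vector [0, 1]]"
  define MC :: "real^2^2" where "MC = vector [vector [-1, 1], vector [-1, 0]]"
  have dets: "det MA = 1" "det MC = 1"
    by (simp_all add: MA_def MC_def det_2)
  have gens: "psl_A n = abs_psl2r MA" "psl_C = abs_psl2r MC"
    by (simp_all add: psl_A_def psl_C_def MA_def MC_def)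
  have "psl_A n * psl_C ^ 2 = abs_psl2r (MA ** (MC ** MC))"
    by (simp add: gens power2_eq_square times_psl2r.abs_eq sl2_eq_up_to_sign_def dets det_mul)
  moreover have "(MA ** (MC ** MC))$1$1 + (MA ** (MC ** MC))$2$2 = 2 * cos (pi / real n)"
    by (simp add: MA_def MC_def matrix_matrix_mult_def sum_2)
  ultimately show ?thesis
    using rotation_power_eq_one[OF assms] dets by (simp add: det_mul)
qed

section \<open>Telescoping of conjugated products\<close>

lemma conjugated_product_telescope:
  fixes x p q :: psl2r and a b :: "nat \<Rightarrow> nat"
  defines "e \<equiv> x * p * inverse x" and "f \<equiv> x * q * inverse x"
    and "g \<equiv> x * (q * inverse p) * inverse x"
  assumes "s > 1" and "\<forall>i\<in>{1..s-1}. b i \<ge> 1"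
  shows "x * (\<Prod>i\<leftarrow>rev [1..<s]. p ^ a (i + 1) * q ^ b i)
    = e ^ a s * f ^ (b (s - 1) - 1) * g
        * (\<Prod>i\<leftarrow>rev [2..<s]. e ^ (1 + a i) * f ^ (b (i - 1) - 1) * g) * x * p"
proof -
  \<comment> \<open>The factor \<open>g\<close> supplies the last \<open>q\<close> of the block together with a surplus \<open>p\<^sup>-\<^sup>1\<close>,
     for which the final \<open>p\<close> compensates.\<close>
  have block: "x * (p ^ l * q ^ m) = e ^ l * f ^ (m - 1) * g * x * p" if "m \<ge> 1" for l m
  proof -
    have "q ^ m = q ^ (m - 1) * q"
      using that by (simp flip: power_Suc2)
    then show ?thesis
      unfolding e_def f_def g_def psl2r_power_conjugate by (simp add: psl2r_word_simps)
  qed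
  from \<open>s > 1\<close> have "s \<ge> 2" by simp
  then show ?thesis
    using assms(5)
  proof (induction s rule: nat_induct_at_least)
    case base
    then show ?case
      using block[of "b 1" "a 2"] by (simp add: numeral_2_eq_2)
  next
    case (Suc s)
    let ?R = "\<Prod>i\<leftarrow>rev [1..<s]. p ^ a (i + 1) * q ^ b i"
    let ?T = "\<Prod>i\<leftarrow>rev [2..<s]. e ^ (1 + a i) * f ^ (b (i - 1) - 1) * g"
    have IH: "x * ?R = e ^ a s * f ^ (b (s - 1) - 1) * g * ?T * x * p"
      using Suc.prems by (intro Suc.IH) auto
    have "x * (\<Prod>i\<leftarrow>rev [1..<Suc s]. p ^ a (i + 1) * q ^ b i)
        = x * (p ^ a (Suc s) * q ^ b s) * ?R"
      using Suc.hyps by (simp add: mult.assoc)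
    also have "\<dots> = e ^ a (Suc s) * f ^ (b s - 1) * g * (e * (x * ?R))"
      using Suc by (subst block) (simp_all add: e_def psl2r_word_simps)
    also have "\<dots> = e ^ a (Suc s) * f ^ (b s - 1) * g
        * (e ^ (1 + a s) * f ^ (b (s - 1) - 1) * g * ?T) * x * p"
      unfolding IH by (simp add: mult.assoc)
    finally show ?case
      using Suc.hyps by (simp add: mult.assoc)
  qed
qed

section \<open>The block identity\<close>

text \<open>Cancelling \<open>B\<^sup>n\<close> gives \<open>U = AC B\<^sup>-\<^sup>2\<close>; here \<open>AC = B C\<^sup>-\<^sup>1\<close> since \<open>C\<^sup>3 = 1\<close>, and
  \<open>C\<^sup>-\<^sup>1 B\<^sup>-\<^sup>1 = A\<^sup>-\<^sup>1\<close>.\<close>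
lemma psl_U_conjugate:
  assumes "n \<ge> 2"
  shows "psl_U n = (psl_A n * psl_C ^ 2) * inverse (psl_A n) * inverse (psl_A n * psl_C ^ 2)"
proof -
  define B where "B = psl_A n * psl_C ^ 2"
  have "B * B * B ^ (n - 2) = B ^ n"
    using assms by (metis power2_eq_square power_add le_add_diff_inverse)
  then have "B ^ (n - 2) = inverse (B * B)"
    using psl_A_C_squared_order[OF assms] psl2r_inverse_unique by (metis B_def)
  then have "psl_U n = psl_A n * psl_C * inverse (B * B)"
    by (simp add: psl_U_def B_def)
  also have "psl_C = psl_C ^ 2 * psl_C ^ 2"
    by (metis psl2r_inverse_mult psl2r_inverse_inverse psl_C_squared power2_eq_square)
  finally show ?thesis
    unfolding B_def psl_C_squared by (simp add: psl2r_word_simps)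
qed

theorem proposition72:
  fixes n k s :: nat and a b :: "nat \<Rightarrow> nat"
  assumes "n \<ge> 3" and "k \<ge> 1" and "s > 1"
    and "\<forall>i\<in>{1..s}. a i \<ge> 1" and "\<forall>i\<in>{1..s-1}. b i \<ge> 1"
  shows
    "let A = psl_A n; C = psl_C; U = psl_U n;
         E = (A * C ^ 2) ^ (n - 3) * U powi (int k - 2) * A * C;
         F = (A * C ^ 2) ^ (n - 3) * U ^ (k - 1) * A * C;
         G = (A * C ^ 2) ^ (n - 3) * A * C * A * C ^ 2
     in C * inverse A * C
          * (\<Prod>i\<leftarrow>rev [1..<s]. (A powi (- int k) * C) ^ a (i + 1) * (A powi (- (int k + 1)) * C) ^ b i)
          * (A powi (- int k) * C) ^ a 1 * inverse A
      = E ^ a s * F ^ (b (s - 1) - 1) * G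
          * (\<Prod>i\<leftarrow>rev [2..<s]. E ^ (1 + a i) * F ^ (b (i - 1) - 1) * G)
          * E ^ a 1 * (A * C ^ 2) ^ (n - 3) * U ^ (k - 1)"
proof -
  define A where "A = psl_A n"
  define C where "C = psl_C"
  define U where "U = psl_U n"
  define B where "B = A * C ^ 2"
  define A' where "A' = inverse A ^ k"
  define E where "E = B ^ (n - 3) * U powi (int k - 2) * A * C"
  define F where "F = B ^ (n - 3) * U ^ (k - 1) * A * C"
  define G where "G = B ^ (n - 3) * A * C * A * C ^ 2"
  define X where "X = C * inverse A * C"
  define P where "P = A powi (- int k) * C"
  define Q where "Q = A powi (- (int k + 1)) * C"

  have P: "P = A' * C" and Q: "Q = inverse A * A' * C"
    using \<open>k \<ge> 1\<close> by (simp_all add: P_def Q_def A'_def power_int_def nat_add_distrib)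
  have Q': "Q = A' * inverse A * C"
    unfolding Q A'_def by (simp only: power_commutes)
  have C2: "C ^ 2 = inverse C" and CC: "C * C = inverse C"
    using psl_C_squared by (simp_all add: C_def power2_eq_square)
  have CC': "C * (C * y) = inverse C * y" for y
    using CC by (metis mult.assoc)
  have iCC: "inverse C * inverse C = C"
    by (metis CC psl2r_inverse_mult psl2r_inverse_inverse)
  have iCC': "inverse C * (inverse C * y) = C * y" for y
    using iCC by (metis mult.assoc)
  have B: "B = A * inverse C"
    by (simp add: B_def C2)
  have "B ^ 3 * B ^ (n - 3) = B ^ n"
    using \<open>n \<ge> 3\<close> by (metis power_add le_add_diff_inverse)
  then have Bn: "B ^ (n - 3) = inverse (B ^ 3)"
    using psl_A_C_squared_order[of n] \<open>n \<ge> 3\<close> psl2r_inverse_unique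
    by (simp add: B_def A_def C_def)
  have U: "U = B * inverse A * inverse B"
    using psl_U_conjugate[of n] \<open>n \<ge> 3\<close> by (simp add: U_def B_def A_def C_def)
  have Upow: "U ^ m = B * inverse A ^ m * inverse B" for m
    unfolding U by (rule psl2r_power_conjugate)

  \<comment> \<open>The exponents \<open>k - 1\<close> and \<open>k - 2\<close> are traded for \<open>k\<close>, so that only one power of \<open>A\<close>
     occurs in the words to be compared. For \<open>k = 1\<close> the exponent \<open>k - 2\<close> is negative.\<close>
  have AA': "A * A' = inverse A ^ (k - 1)"
    using \<open>k \<ge> 1\<close> by (cases k) (simp_all add: A'_def psl2r_cancel)
  also have "\<dots> = A' * A"
    using \<open>k \<ge> 1\<close> by (cases k) (simp_all add: A'_def psl2r_word_simps del: power_Suc add: power_Suc2)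
  finally have commute: "A * A' = A' * A" .
  from AA' have U1: "U ^ (k - 1) = B * (A * A') * inverse B"
    by (simp add: Upow)
  have U2: "U powi (int k - 2) = B * (A * (A' * A)) * inverse B"
  proof (cases "k = 1")
    case True
    then show ?thesis
      by (simp add: power_int_def U A'_def psl2r_word_simps)
  next
    case False
    with \<open>k \<ge> 1\<close> obtain j where "k = Suc (Suc j)"
      by (metis One_nat_def Suc_le_D less_eq_nat.simps(1) not0_implies_Suc)
    then show ?thesis
      unfolding commute[symmetric]
      by (simp add: power_int_def Upow A'_def psl2r_cancel nat_add_distrib)
  qed

  note word_simps = psl2r_word_simps CC CC' iCC iCC'
  have E: "E = X * P * inverse X"
    unfolding E_def Bn U2 unfolding B X_def P by (simp add: word_simps power3_eq_cube)
  have F: "F = X * Q * inverse X"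
    unfolding F_def Bn U1 unfolding B X_def Q' by (simp add: word_simps power3_eq_cube)
  have G: "G = X * (Q * inverse P) * inverse X"
    unfolding G_def Bn C2 unfolding B X_def P Q by (simp add: word_simps power3_eq_cube)
  have last_factor: "B ^ (n - 3) * U ^ (k - 1) = X * P * inverse A"
    unfolding Bn U1 unfolding B X_def P by (simp add: word_simps power3_eq_cube)

  let ?T = "\<Prod>i\<leftarrow>rev [2..<s]. E ^ (1 + a i) * F ^ (b (i - 1) - 1) * G"
  have "X * (\<Prod>i\<leftarrow>rev [1..<s]. P ^ a (i + 1) * Q ^ b i) * P ^ a 1 * inverse A
      = E ^ a s * F ^ (b (s - 1) - 1) * G * ?T * X * P * P ^ a 1 * inverse A"
    unfolding E F G using assms(3,5) by (subst conjugated_product_telescope) simp_all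
  also have "\<dots> = E ^ a s * F ^ (b (s - 1) - 1) * G * ?T * (X * P ^ a 1 * P * inverse A)"
    by (simp add: mult.assoc flip: power_commutes)
  also have "X * P ^ a 1 * P * inverse A = E ^ a 1 * (B ^ (n - 3) * U ^ (k - 1))"
    unfolding last_factor unfolding E psl2r_power_conjugate by (simp add: psl2r_word_simps)
  finally have "X * (\<Prod>i\<leftarrow>rev [1..<s]. P ^ a (i + 1) * Q ^ b i) * P ^ a 1 * inverse A
      = E ^ a s * F ^ (b (s - 1) - 1) * G * ?T * E ^ a 1 * B ^ (n - 3) * U ^ (k - 1)"
    by (simp only: mult.assoc)
  then show ?thesis
    unfolding Let_def A_def[symmetric] C_def[symmetric] U_def[symmetric] B_def[symmetric]
      E_def[symmetric] F_def[symmetric] G_def[symmetric] X_def[symmetric]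
      P_def[symmetric] Q_def[symmetric] .
qed

end
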